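(* Let $\mathbb{A}$ and $\mathbb{X}$ be normal, vertically weak double categories. Let $F\colon\mathbb{X}\to\mathbb{A}$ and $G\colon\mathbb{A}\to\mathbb{X}$ be strict double functors, that is, $F$ and $G$ strictly preserve all compositions and identities of $\mathbb{X}$ respectively $\mathbb{A}$. Then there exist strict horizontal natural transformations $\eta\colon1_{\mathbb{X}}\Rightarrow GF$ and $\varepsilon\colon FG\Rightarrow1_{\mathbb{A}}$ satisfying the two triangle identities if and only if there exist bijections $$\varphi_{j,k}\colon\mathbb{A}(Fj,k)\to\mathbb{X}(j,Gk),$$ for all vertical morphisms $j$ of $\mathbb{X}$ and $k$ of $\mathbb{A}$, which are natural in $j$ and $k$, i.e. $\varphi([F\sigma\ \ \alpha])=[\sigma\ \ \varphi(\alpha)]$ and $\varphi([\alpha\ \ \tau])=[\varphi(\alpha)\ \ G\tau]$ for all squares $\sigma\in\mathbb{X}(j',j)$, $\alpha\in\mathbb{A}(Fj,k)$, $\tau\in\mathbb{A}(k,k')$, and compatible with vertical composition, which means $\varphi\left(\begin{bmatrix}\alpha\\ \beta\end{bmatrix}\right)=\begin{bmatrix}\varphi(\alpha)\\ \varphi(\beta)\end{bmatrix}$.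
   Context: A vertically weak double category is like a (strict) double category (objects, horizontal morphisms, vertical morphisms, squares) except that composition of vertical morphisms is associative and unital only up to coherent horizontally invertible squares; horizontal composition is strictly associative and unital, and the interchange law holds strictly. It is normal if the coherence unit squares are identity squares, so that vertical identity morphisms $1^v_A$ are strict identities; then for each vertical morphism $j$ the square $i^h_j$ is a strict identity for horizontal composition of squares. $[\alpha\ \beta]$ denotes horizontal composition of squares ($\alpha$ on the left), $\begin{bmatrix}\alpha\\ \beta\end{bmatrix}$ vertical composition ($\alpha$ on top), and $i^v_f$ the vertical identity square of a horizontal morphism $f$. $\mathbb{D}(j,k)$ is the set of squares of $\mathbb{D}$ with left side $j$ and right side $k$. A strict horizontal natural transformation $\theta\colon F\Rightarrow G$ assigns to each object $A$ a horizontal morphism $\theta_A\colon FA\to GA$ and to each vertical morphism $j\colon A\to C$ a square $\theta_j$ with left $Fj$, right $Gj$, top $\theta_A$, bottom $\theta_C$, such that $\theta_{1^v_A}=i^v_{\theta_A}$, $\theta_{\begin{bmatrix}j_1\\ j_2\end{bmatrix}}=\begin{bmatrix}\theta_{j_1}\\ \theta_{j_2}\end{bmatrix}$, and $[F\alpha\ \theta_k]=[\theta_j\ G\alpha]$ for each square $\alpha$ with left $j$ and right $k$. The triangle identities are $[\eta_{Gk}\ G\varepsilon_k]=i^h_{Gk}$ and $[F\eta_j\ \varepsilon_{Fj}]=i^h_{Fj}$ for all vertical morphisms $k$ of $\mathbb{A}$, $j$ of $\mathbb{X}$ (together with the corresponding equations of horizontal morphisms on objects). *)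

theory Defs
  imports Main
begin

text \<open>
  All compositions are written in diagrammatic order: \<open>f \<cdot> g\<close> is first \<open>f\<close>, then \<open>g\<close>;
  \<open>\<alpha> \<parallel> \<beta>\<close> has \<open>\<alpha>\<close> on the left; \<open>j \<bullet> k\<close> and \<open>\<alpha> \<ominus> \<beta>\<close> have the first argument on top.
  Compositions are total functions whose values matter only on composable arguments from
  the carrier sets.
\<close>

record ('o, 'h, 'v, 's) double_cat =
  Obj :: "'o set"
  Hor :: "'h set"
  hdom :: "'h \<Rightarrow> 'o"
  hcod :: "'h \<Rightarrow> 'o"
  hid :: "'o \<Rightarrow> 'h"
  hcomp :: "'h \<Rightarrow> 'h \<Rightarrow> 'h"  (infixl "\<cdot>\<index>" 70)
  Ver :: "'v set"
  vdom :: "'v \<Rightarrow> 'o"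
  vcod :: "'v \<Rightarrow> 'o"
  vid :: "'o \<Rightarrow> 'v"
  vcomp :: "'v \<Rightarrow> 'v \<Rightarrow> 'v"  (infixl "\<bullet>\<index>" 70)
  Sq :: "'s set"
  lside :: "'s \<Rightarrow> 'v"
  rside :: "'s \<Rightarrow> 'v"
  tside :: "'s \<Rightarrow> 'h"
  bside :: "'s \<Rightarrow> 'h"
  sq_hid :: "'v \<Rightarrow> 's"
  sq_hcomp :: "'s \<Rightarrow> 's \<Rightarrow> 's"  (infixl "\<parallel>\<index>" 70)
  sq_vid :: "'h \<Rightarrow> 's"
  sq_vcomp :: "'s \<Rightarrow> 's \<Rightarrow> 's"  (infixl "\<ominus>\<index>" 70)
  vassoc :: "'v \<Rightarrow> 'v \<Rightarrow> 'v \<Rightarrow> 's"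
  vlunit :: "'v \<Rightarrow> 's"
  vrunit :: "'v \<Rightarrow> 's"

definition squares :: "('o, 'h, 'v, 's) double_cat \<Rightarrow> 'v \<Rightarrow> 'v \<Rightarrow> 's set" where
  "squares D j k = {\<alpha> \<in> Sq D. lside D \<alpha> = j \<and> rside D \<alpha> = k}"

definition horizontally_invertible :: "('o, 'h, 'v, 's) double_cat \<Rightarrow> 's \<Rightarrow> bool" where
  "horizontally_invertible D \<alpha> \<longleftrightarrow> \<alpha> \<in> Sq D \<and>
     (\<exists>\<beta> \<in> squares D (rside D \<alpha>) (lside D \<alpha>).
        \<alpha> \<parallel>\<^bsub>D\<^esub> \<beta> = sq_hid D (lside D \<alpha>) \<and> \<beta> \<parallel>\<^bsub>D\<^esub> \<alpha> = sq_hid D (rside D \<alpha>))"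

definition coherence_square :: "('o, 'h, 'v, 's) double_cat \<Rightarrow> 'v \<Rightarrow> 'v \<Rightarrow> 's \<Rightarrow> bool" where
  "coherence_square D j k \<alpha> \<longleftrightarrow> \<alpha> \<in> squares D j k \<and>
     tside D \<alpha> = hid D (vdom D j) \<and> bside D \<alpha> = hid D (vcod D j) \<and>
     horizontally_invertible D \<alpha>"

locale vertically_weak_double_category =
  fixes D :: "('o, 'h, 'v, 's) double_cat" (structure)
  assumes
    hor_closed: "f \<in> Hor D \<Longrightarrow> hdom D f \<in> Obj D \<and> hcod D f \<in> Obj D" and
    hid_closed: "A \<in> Obj D \<Longrightarrow> hid D A \<in> Hor D \<and> hdom D (hid D A) = A \<and> hcod D (hid D A) = A" and
    hcomp_closed: "\<lbrakk>f \<in> Hor D; g \<in> Hor D; hcod D f = hdom D g\<rbrakk> \<Longrightarrow>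
      f \<cdot> g \<in> Hor D \<and> hdom D (f \<cdot> g) = hdom D f \<and> hcod D (f \<cdot> g) = hcod D g" and
    hcomp_unit: "f \<in> Hor D \<Longrightarrow> hid D (hdom D f) \<cdot> f = f \<and> f \<cdot> hid D (hcod D f) = f" and
    hcomp_assoc: "\<lbrakk>f \<in> Hor D; g \<in> Hor D; h \<in> Hor D; hcod D f = hdom D g; hcod D g = hdom D h\<rbrakk> \<Longrightarrow>
      (f \<cdot> g) \<cdot> h = f \<cdot> (g \<cdot> h)" and
    ver_closed: "j \<in> Ver D \<Longrightarrow> vdom D j \<in> Obj D \<and> vcod D j \<in> Obj D" and
    vid_closed: "A \<in> Obj D \<Longrightarrow> vid D A \<in> Ver D \<and> vdom D (vid D A) = A \<and> vcod D (vid D A) = A" and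
    vcomp_closed: "\<lbrakk>j \<in> Ver D; k \<in> Ver D; vcod D j = vdom D k\<rbrakk> \<Longrightarrow>
      j \<bullet> k \<in> Ver D \<and> vdom D (j \<bullet> k) = vdom D j \<and> vcod D (j \<bullet> k) = vcod D k" and
    sq_closed: "\<alpha> \<in> Sq D \<Longrightarrow>
      lside D \<alpha> \<in> Ver D \<and> rside D \<alpha> \<in> Ver D \<and> tside D \<alpha> \<in> Hor D \<and> bside D \<alpha> \<in> Hor D \<and>
      hdom D (tside D \<alpha>) = vdom D (lside D \<alpha>) \<and> hcod D (tside D \<alpha>) = vdom D (rside D \<alpha>) \<and>
      hdom D (bside D \<alpha>) = vcod D (lside D \<alpha>) \<and> hcod D (bside D \<alpha>) = vcod D (rside D \<alpha>)" and
    sq_hid_closed: "j \<in> Ver D \<Longrightarrow> sq_hid D j \<in> squares D j j \<and>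
      tside D (sq_hid D j) = hid D (vdom D j) \<and> bside D (sq_hid D j) = hid D (vcod D j)" and
    sq_hcomp_closed: "\<lbrakk>\<alpha> \<in> Sq D; \<beta> \<in> Sq D; rside D \<alpha> = lside D \<beta>\<rbrakk> \<Longrightarrow>
      \<alpha> \<parallel> \<beta> \<in> squares D (lside D \<alpha>) (rside D \<beta>) \<and>
      tside D (\<alpha> \<parallel> \<beta>) = tside D \<alpha> \<cdot> tside D \<beta> \<and> bside D (\<alpha> \<parallel> \<beta>) = bside D \<alpha> \<cdot> bside D \<beta>" and
    sq_hcomp_unit: "\<alpha> \<in> Sq D \<Longrightarrow>
      sq_hid D (lside D \<alpha>) \<parallel> \<alpha> = \<alpha> \<and> \<alpha> \<parallel> sq_hid D (rside D \<alpha>) = \<alpha>" and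
    sq_hcomp_assoc: "\<lbrakk>\<alpha> \<in> Sq D; \<beta> \<in> Sq D; \<gamma> \<in> Sq D;
        rside D \<alpha> = lside D \<beta>; rside D \<beta> = lside D \<gamma>\<rbrakk> \<Longrightarrow>
      (\<alpha> \<parallel> \<beta>) \<parallel> \<gamma> = \<alpha> \<parallel> (\<beta> \<parallel> \<gamma>)" and
    sq_vid_closed: "f \<in> Hor D \<Longrightarrow>
      sq_vid D f \<in> squares D (vid D (hdom D f)) (vid D (hcod D f)) \<and>
      tside D (sq_vid D f) = f \<and> bside D (sq_vid D f) = f" and
    sq_vcomp_closed: "\<lbrakk>\<alpha> \<in> Sq D; \<beta> \<in> Sq D; bside D \<alpha> = tside D \<beta>\<rbrakk> \<Longrightarrow>
      \<alpha> \<ominus> \<beta> \<in> squares D (lside D \<alpha> \<bullet> lside D \<beta>) (rside D \<alpha> \<bullet> rside D \<beta>) \<and>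
      tside D (\<alpha> \<ominus> \<beta>) = tside D \<alpha> \<and> bside D (\<alpha> \<ominus> \<beta>) = bside D \<beta>" and
    sq_vid_hid: "A \<in> Obj D \<Longrightarrow> sq_vid D (hid D A) = sq_hid D (vid D A)" and
    sq_vid_hcomp: "\<lbrakk>f \<in> Hor D; g \<in> Hor D; hcod D f = hdom D g\<rbrakk> \<Longrightarrow>
      sq_vid D (f \<cdot> g) = sq_vid D f \<parallel> sq_vid D g" and
    sq_hid_vcomp: "\<lbrakk>j \<in> Ver D; k \<in> Ver D; vcod D j = vdom D k\<rbrakk> \<Longrightarrow>
      sq_hid D (j \<bullet> k) = sq_hid D j \<ominus> sq_hid D k" and
    interchange: "\<lbrakk>\<alpha> \<in> Sq D; \<beta> \<in> Sq D; \<gamma> \<in> Sq D; \<delta> \<in> Sq D;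
        rside D \<alpha> = lside D \<beta>; rside D \<gamma> = lside D \<delta>;
        bside D \<alpha> = tside D \<gamma>; bside D \<beta> = tside D \<delta>\<rbrakk> \<Longrightarrow>
      (\<alpha> \<parallel> \<beta>) \<ominus> (\<gamma> \<parallel> \<delta>) = (\<alpha> \<ominus> \<gamma>) \<parallel> (\<beta> \<ominus> \<delta>)" and
    vassoc_coherence: "\<lbrakk>j \<in> Ver D; k \<in> Ver D; l \<in> Ver D; vcod D j = vdom D k; vcod D k = vdom D l\<rbrakk> \<Longrightarrow>
      coherence_square D ((j \<bullet> k) \<bullet> l) (j \<bullet> (k \<bullet> l)) (vassoc D j k l)" and
    vlunit_coherence: "j \<in> Ver D \<Longrightarrow> coherence_square D (vid D (vdom D j) \<bullet> j) j (vlunit D j)" and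
    vrunit_coherence: "j \<in> Ver D \<Longrightarrow> coherence_square D (j \<bullet> vid D (vcod D j)) j (vrunit D j)" and
    vassoc_natural: "\<lbrakk>\<alpha> \<in> Sq D; \<beta> \<in> Sq D; \<gamma> \<in> Sq D;
        bside D \<alpha> = tside D \<beta>; bside D \<beta> = tside D \<gamma>\<rbrakk> \<Longrightarrow>
      ((\<alpha> \<ominus> \<beta>) \<ominus> \<gamma>) \<parallel> vassoc D (rside D \<alpha>) (rside D \<beta>) (rside D \<gamma>) =
      vassoc D (lside D \<alpha>) (lside D \<beta>) (lside D \<gamma>) \<parallel> (\<alpha> \<ominus> (\<beta> \<ominus> \<gamma>))" and
    vlunit_natural: "\<alpha> \<in> Sq D \<Longrightarrow>
      (sq_vid D (tside D \<alpha>) \<ominus> \<alpha>) \<parallel> vlunit D (rside D \<alpha>) = vlunit D (lside D \<alpha>) \<parallel> \<alpha>" and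
    vrunit_natural: "\<alpha> \<in> Sq D \<Longrightarrow>
      (\<alpha> \<ominus> sq_vid D (bside D \<alpha>)) \<parallel> vrunit D (rside D \<alpha>) = vrunit D (lside D \<alpha>) \<parallel> \<alpha>" and
    pentagon: "\<lbrakk>j \<in> Ver D; k \<in> Ver D; l \<in> Ver D; m \<in> Ver D;
        vcod D j = vdom D k; vcod D k = vdom D l; vcod D l = vdom D m\<rbrakk> \<Longrightarrow>
      vassoc D (j \<bullet> k) l m \<parallel> vassoc D j k (l \<bullet> m) =
      (vassoc D j k l \<ominus> sq_hid D m) \<parallel> vassoc D j (k \<bullet> l) m \<parallel> (sq_hid D j \<ominus> vassoc D k l m)" and
    triangle: "\<lbrakk>j \<in> Ver D; k \<in> Ver D; vcod D j = vdom D k\<rbrakk> \<Longrightarrow>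
      vassoc D j (vid D (vcod D j)) k \<parallel> (sq_hid D j \<ominus> vlunit D k) = vrunit D j \<ominus> sq_hid D k"

text \<open>
  Comparing sides, the two axioms below contain \<open>vid (vdom j) \<bullet> j = j = j \<bullet> vid (vcod j)\<close>.
\<close>
locale normal_vertically_weak_double_category = vertically_weak_double_category +
  assumes
    vlunit_identity: "j \<in> Ver D \<Longrightarrow> vlunit D j = sq_hid D j" and
    vrunit_identity: "j \<in> Ver D \<Longrightarrow> vrunit D j = sq_hid D j"

record ('o, 'h, 'v, 's, 'p, 'i, 'w, 't) double_map =
  on_obj :: "'o \<Rightarrow> 'p"
  on_hor :: "'h \<Rightarrow> 'i"
  on_ver :: "'v \<Rightarrow> 'w"
  on_sq :: "'s \<Rightarrow> 't"

text \<open>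
  Strictness is preservation of all compositions and identities; preservation of the
  associativity squares is not demanded.
\<close>
locale strict_double_functor =
  fixes X :: "('o, 'h, 'v, 's) double_cat"
    and A :: "('p, 'i, 'w, 't) double_cat"
    and F :: "('o, 'h, 'v, 's, 'p, 'i, 'w, 't) double_map"
  assumes
    on_obj: "B \<in> Obj X \<Longrightarrow> on_obj F B \<in> Obj A" and
    on_hor: "f \<in> Hor X \<Longrightarrow> on_hor F f \<in> Hor A \<and>
      hdom A (on_hor F f) = on_obj F (hdom X f) \<and> hcod A (on_hor F f) = on_obj F (hcod X f)" and
    on_ver: "j \<in> Ver X \<Longrightarrow> on_ver F j \<in> Ver A \<and>
      vdom A (on_ver F j) = on_obj F (vdom X j) \<and> vcod A (on_ver F j) = on_obj F (vcod X j)" and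
    on_sq: "\<alpha> \<in> Sq X \<Longrightarrow> on_sq F \<alpha> \<in> Sq A \<and>
      lside A (on_sq F \<alpha>) = on_ver F (lside X \<alpha>) \<and> rside A (on_sq F \<alpha>) = on_ver F (rside X \<alpha>) \<and>
      tside A (on_sq F \<alpha>) = on_hor F (tside X \<alpha>) \<and> bside A (on_sq F \<alpha>) = on_hor F (bside X \<alpha>)" and
    pres_hid: "B \<in> Obj X \<Longrightarrow> on_hor F (hid X B) = hid A (on_obj F B)" and
    pres_hcomp: "\<lbrakk>f \<in> Hor X; g \<in> Hor X; hcod X f = hdom X g\<rbrakk> \<Longrightarrow>
      on_hor F (f \<cdot>\<^bsub>X\<^esub> g) = on_hor F f \<cdot>\<^bsub>A\<^esub> on_hor F g" and
    pres_vid: "B \<in> Obj X \<Longrightarrow> on_ver F (vid X B) = vid A (on_obj F B)" and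
    pres_vcomp: "\<lbrakk>j \<in> Ver X; k \<in> Ver X; vcod X j = vdom X k\<rbrakk> \<Longrightarrow>
      on_ver F (j \<bullet>\<^bsub>X\<^esub> k) = on_ver F j \<bullet>\<^bsub>A\<^esub> on_ver F k" and
    pres_sq_hid: "j \<in> Ver X \<Longrightarrow> on_sq F (sq_hid X j) = sq_hid A (on_ver F j)" and
    pres_sq_hcomp: "\<lbrakk>\<alpha> \<in> Sq X; \<beta> \<in> Sq X; rside X \<alpha> = lside X \<beta>\<rbrakk> \<Longrightarrow>
      on_sq F (\<alpha> \<parallel>\<^bsub>X\<^esub> \<beta>) = on_sq F \<alpha> \<parallel>\<^bsub>A\<^esub> on_sq F \<beta>" and
    pres_sq_vid: "f \<in> Hor X \<Longrightarrow> on_sq F (sq_vid X f) = sq_vid A (on_hor F f)" and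
    pres_sq_vcomp: "\<lbrakk>\<alpha> \<in> Sq X; \<beta> \<in> Sq X; bside X \<alpha> = tside X \<beta>\<rbrakk> \<Longrightarrow>
      on_sq F (\<alpha> \<ominus>\<^bsub>X\<^esub> \<beta>) = on_sq F \<alpha> \<ominus>\<^bsub>A\<^esub> on_sq F \<beta>"

definition id_map :: "('o, 'h, 'v, 's, 'o, 'h, 'v, 's) double_map" where
  "id_map = \<lparr>on_obj = id, on_hor = id, on_ver = id, on_sq = id\<rparr>"

definition comp_map ::
  "('p, 'i, 'w, 't, 'q, 'k, 'x, 'u) double_map \<Rightarrow> ('o, 'h, 'v, 's, 'p, 'i, 'w, 't) double_map \<Rightarrow>
   ('o, 'h, 'v, 's, 'q, 'k, 'x, 'u) double_map"  (infixl "\<circ>\<^sub>d" 55) where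
  "G \<circ>\<^sub>d F = \<lparr>on_obj = on_obj G \<circ> on_obj F, on_hor = on_hor G \<circ> on_hor F,
     on_ver = on_ver G \<circ> on_ver F, on_sq = on_sq G \<circ> on_sq F\<rparr>"

text \<open>
  A transformation is given by its components \<open>to\<close> at objects and \<open>tv\<close> at vertical morphisms.
\<close>
locale strict_horizontal_transformation =
  fixes X :: "('o, 'h, 'v, 's) double_cat"
    and A :: "('p, 'i, 'w, 't) double_cat"
    and F G :: "('o, 'h, 'v, 's, 'p, 'i, 'w, 't) double_map"
    and to :: "'o \<Rightarrow> 'i"
    and tv :: "'v \<Rightarrow> 't"
  assumes
    comp_obj: "B \<in> Obj X \<Longrightarrow> to B \<in> Hor A \<and>
      hdom A (to B) = on_obj F B \<and> hcod A (to B) = on_obj G B" and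
    comp_ver: "j \<in> Ver X \<Longrightarrow> tv j \<in> squares A (on_ver F j) (on_ver G j) \<and>
      tside A (tv j) = to (vdom X j) \<and> bside A (tv j) = to (vcod X j)" and
    comp_vid: "B \<in> Obj X \<Longrightarrow> tv (vid X B) = sq_vid A (to B)" and
    comp_vcomp: "\<lbrakk>j \<in> Ver X; k \<in> Ver X; vcod X j = vdom X k\<rbrakk> \<Longrightarrow>
      tv (j \<bullet>\<^bsub>X\<^esub> k) = tv j \<ominus>\<^bsub>A\<^esub> tv k" and
    naturality: "\<alpha> \<in> Sq X \<Longrightarrow>
      on_sq F \<alpha> \<parallel>\<^bsub>A\<^esub> tv (rside X \<alpha>) = tv (lside X \<alpha>) \<parallel>\<^bsub>A\<^esub> on_sq G \<alpha>"

definition triangle_identities ::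
  "('o, 'h, 'v, 's) double_cat \<Rightarrow> ('p, 'i, 'w, 't) double_cat \<Rightarrow>
   ('o, 'h, 'v, 's, 'p, 'i, 'w, 't) double_map \<Rightarrow> ('p, 'i, 'w, 't, 'o, 'h, 'v, 's) double_map \<Rightarrow>
   ('o \<Rightarrow> 'h) \<Rightarrow> ('v \<Rightarrow> 's) \<Rightarrow> ('p \<Rightarrow> 'i) \<Rightarrow> ('w \<Rightarrow> 't) \<Rightarrow> bool" where
  "triangle_identities X A F G \<eta>o \<eta>v \<epsilon>o \<epsilon>v \<longleftrightarrow>
     (\<forall>B \<in> Obj A. \<eta>o (on_obj G B) \<cdot>\<^bsub>X\<^esub> on_hor G (\<epsilon>o B) = hid X (on_obj G B)) \<and>
     (\<forall>B \<in> Obj X. on_hor F (\<eta>o B) \<cdot>\<^bsub>A\<^esub> \<epsilon>o (on_obj F B) = hid A (on_obj F B)) \<and>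
     (\<forall>k \<in> Ver A. \<eta>v (on_ver G k) \<parallel>\<^bsub>X\<^esub> on_sq G (\<epsilon>v k) = sq_hid X (on_ver G k)) \<and>
     (\<forall>j \<in> Ver X. on_sq F (\<eta>v j) \<parallel>\<^bsub>A\<^esub> \<epsilon>v (on_ver F j) = sq_hid A (on_ver F j))"

definition natural_in_left ::
  "('o, 'h, 'v, 's) double_cat \<Rightarrow> ('p, 'i, 'w, 't) double_cat \<Rightarrow>
   ('o, 'h, 'v, 's, 'p, 'i, 'w, 't) double_map \<Rightarrow> ('v \<Rightarrow> 'w \<Rightarrow> 't \<Rightarrow> 's) \<Rightarrow> bool" where
  "natural_in_left X A F \<phi> \<longleftrightarrow>
     (\<forall>j' \<in> Ver X. \<forall>j \<in> Ver X. \<forall>k \<in> Ver A.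
        \<forall>\<sigma> \<in> squares X j' j. \<forall>\<alpha> \<in> squares A (on_ver F j) k.
          \<phi> j' k (on_sq F \<sigma> \<parallel>\<^bsub>A\<^esub> \<alpha>) = \<sigma> \<parallel>\<^bsub>X\<^esub> \<phi> j k \<alpha>)"

definition natural_in_right ::
  "('o, 'h, 'v, 's) double_cat \<Rightarrow> ('p, 'i, 'w, 't) double_cat \<Rightarrow>
   ('o, 'h, 'v, 's, 'p, 'i, 'w, 't) double_map \<Rightarrow> ('p, 'i, 'w, 't, 'o, 'h, 'v, 's) double_map \<Rightarrow>
   ('v \<Rightarrow> 'w \<Rightarrow> 't \<Rightarrow> 's) \<Rightarrow> bool" where
  "natural_in_right X A F G \<phi> \<longleftrightarrow>
     (\<forall>j \<in> Ver X. \<forall>k \<in> Ver A. \<forall>k' \<in> Ver A.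
        \<forall>\<alpha> \<in> squares A (on_ver F j) k. \<forall>\<tau> \<in> squares A k k'.
          \<phi> j k' (\<alpha> \<parallel>\<^bsub>A\<^esub> \<tau>) = \<phi> j k \<alpha> \<parallel>\<^bsub>X\<^esub> on_sq G \<tau>)"

text \<open>
  The conjunct on sides says that the vertical composite of \<open>\<phi> \<alpha>\<close> and \<open>\<phi> \<beta>\<close> exists, as the
  equation presupposes.  It is stated because \<open>\<ominus>\<close> is a total function.
\<close>
definition vertically_compatible ::
  "('o, 'h, 'v, 's) double_cat \<Rightarrow> ('p, 'i, 'w, 't) double_cat \<Rightarrow>
   ('o, 'h, 'v, 's, 'p, 'i, 'w, 't) double_map \<Rightarrow> ('v \<Rightarrow> 'w \<Rightarrow> 't \<Rightarrow> 's) \<Rightarrow> bool" where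
  "vertically_compatible X A F \<phi> \<longleftrightarrow>
     (\<forall>j\<^sub>1 \<in> Ver X. \<forall>j\<^sub>2 \<in> Ver X. \<forall>k\<^sub>1 \<in> Ver A. \<forall>k\<^sub>2 \<in> Ver A.
        \<forall>\<alpha> \<in> squares A (on_ver F j\<^sub>1) k\<^sub>1. \<forall>\<beta> \<in> squares A (on_ver F j\<^sub>2) k\<^sub>2.
          vcod X j\<^sub>1 = vdom X j\<^sub>2 \<and> vcod A k\<^sub>1 = vdom A k\<^sub>2 \<and> bside A \<alpha> = tside A \<beta> \<longrightarrow>
          bside X (\<phi> j\<^sub>1 k\<^sub>1 \<alpha>) = tside X (\<phi> j\<^sub>2 k\<^sub>2 \<beta>) \<and>
          \<phi> (j\<^sub>1 \<bullet>\<^bsub>X\<^esub> j\<^sub>2) (k\<^sub>1 \<bullet>\<^bsub>A\<^esub> k\<^sub>2) (\<alpha> \<ominus>\<^bsub>A\<^esub> \<beta>) = \<phi> j\<^sub>1 k\<^sub>1 \<alpha> \<ominus>\<^bsub>X\<^esub> \<phi> j\<^sub>2 k\<^sub>2 \<beta>)"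

end

theory Submission
  imports Defs
begin

text \<open>
  Given \<open>\<eta>\<close> and \<open>\<epsilon>\<close>, put \<open>\<phi> \<alpha> = \<eta> j \<parallel> G \<alpha>\<close>, with inverse \<open>\<beta> \<mapsto> F \<beta> \<parallel> \<epsilon> k\<close>.
  Conversely, \<open>\<eta> j\<close> is \<open>\<phi>\<close> of the horizontal identity square at \<open>F j\<close>, and \<open>\<epsilon> k\<close> is the
  \<open>\<phi>\<close>-preimage of the horizontal identity square at \<open>G k\<close>.  The delicate point is that \<open>\<phi>\<close> is
  not assumed to preserve vertical identity squares, so the conditions on the sides of \<open>\<eta>\<close> and
  \<open>\<epsilon>\<close> and on their values at vertical identities need an argument.  A preimage under \<open>\<phi>\<close> of a
  vertical identity square is again one, because it can be composed with the identity on its top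
  side; this settles \<open>\<epsilon>\<close> at vertical identities.  With \<open>a\<close> the top side of \<open>\<eta>\<close> at \<open>vid B\<close>, the
  triangle identity then exhibits the vertical identity square on \<open>a\<close> as \<open>\<eta> (vid B)\<close>.  Finally,
  \<open>\<phi> \<alpha> = \<eta> j \<parallel> G \<alpha>\<close> shows that \<open>\<phi>\<close> preserves those vertical identity squares whose top side
  occurs as a side of some \<open>\<epsilon> k\<close>, and this identifies the sides of \<open>\<epsilon> k\<close>.
\<close>

section \<open>Squares with prescribed left and right sides\<close>

lemma squares_iff: "\<alpha> \<in> squares D j k \<longleftrightarrow> \<alpha> \<in> Sq D \<and> lside D \<alpha> = j \<and> rside D \<alpha> = k"
  by (auto simp: squares_def)

context vertically_weak_double_category
begin

lemma squares_hcomp: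
  "\<lbrakk>\<alpha> \<in> squares D j k; \<beta> \<in> squares D k l\<rbrakk> \<Longrightarrow> \<alpha> \<parallel> \<beta> \<in> squares D j l"
  using sq_hcomp_closed by (auto simp: squares_iff)

lemma squares_hcomp_sides:
  assumes "\<alpha> \<in> squares D j k" "\<beta> \<in> squares D k l"
  shows "tside D (\<alpha> \<parallel> \<beta>) = tside D \<alpha> \<cdot> tside D \<beta>" "bside D (\<alpha> \<parallel> \<beta>) = bside D \<alpha> \<cdot> bside D \<beta>"
  using assms sq_hcomp_closed by (auto simp: squares_iff)

lemma squares_hcomp_unit:
  assumes "\<alpha> \<in> squares D j k"
  shows "sq_hid D j \<parallel> \<alpha> = \<alpha>" "\<alpha> \<parallel> sq_hid D k = \<alpha>"
  using assms sq_hcomp_unit by (auto simp: squares_iff)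

lemma squares_hcomp_assoc:
  assumes "\<alpha> \<in> squares D j k" "\<beta> \<in> squares D k l" "\<gamma> \<in> squares D l m"
  shows "(\<alpha> \<parallel> \<beta>) \<parallel> \<gamma> = \<alpha> \<parallel> (\<beta> \<parallel> \<gamma>)"
  using assms sq_hcomp_assoc by (auto simp: squares_iff)

lemma squares_Ver:
  assumes "\<alpha> \<in> squares D j k"
  shows "j \<in> Ver D" "k \<in> Ver D"
  using assms sq_closed by (auto simp: squares_iff)

lemma squares_tside:
  assumes "\<alpha> \<in> squares D j k"
  shows "tside D \<alpha> \<in> Hor D" "hdom D (tside D \<alpha>) = vdom D j" "hcod D (tside D \<alpha>) = vdom D k"
  using assms sq_closed by (auto simp: squares_iff)

lemma squares_bside:
  assumes "\<alpha> \<in> squares D j k"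
  shows "bside D \<alpha> \<in> Hor D" "hdom D (bside D \<alpha>) = vcod D j" "hcod D (bside D \<alpha>) = vcod D k"
  using assms sq_closed by (auto simp: squares_iff)

lemma squares_vcomp:
  assumes "\<alpha> \<in> squares D j k" "\<beta> \<in> squares D l m" "bside D \<alpha> = tside D \<beta>"
  shows "\<alpha> \<ominus> \<beta> \<in> squares D (j \<bullet> l) (k \<bullet> m)"
    "tside D (\<alpha> \<ominus> \<beta>) = tside D \<alpha>" "bside D (\<alpha> \<ominus> \<beta>) = bside D \<beta>"
  using assms sq_vcomp_closed by (auto simp: squares_iff)

lemma squares_vcomp_vcod:
  assumes "\<alpha> \<in> squares D j k" "\<beta> \<in> squares D l m" "bside D \<alpha> = tside D \<beta>"
  shows "vcod D j = vdom D l" "vcod D k = vdom D m"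
  using assms squares_tside squares_bside by metis+

lemma sq_hid_in_squares: "j \<in> Ver D \<Longrightarrow> sq_hid D j \<in> squares D j j"
  using sq_hid_closed by blast

lemma sq_hid_sides:
  assumes "j \<in> Ver D"
  shows "tside D (sq_hid D j) = hid D (vdom D j)" "bside D (sq_hid D j) = hid D (vcod D j)"
  using assms sq_hid_closed by blast+

end

section \<open>Strict vertical units in the normal case\<close>

context normal_vertically_weak_double_category
begin

text \<open>Normality makes the unit coherence squares horizontal identities, whose left and right
  sides coincide.\<close>

lemma vcomp_vid:
  assumes "j \<in> Ver D"
  shows "vid D (vdom D j) \<bullet> j = j" "j \<bullet> vid D (vcod D j) = j"
  using vlunit_coherence[OF assms] vrunit_coherence[OF assms] sq_hid_closed[OF assms]
    vlunit_identity[OF assms] vrunit_identity[OF assms]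
  by (auto simp: coherence_square_def squares_iff)

text \<open>Naturality of the left unit coherence square, once that square is a horizontal identity,
  is exactly this equation.\<close>

lemma sq_vid_vcomp:
  assumes "\<alpha> \<in> squares D j k"
  shows "sq_vid D (tside D \<alpha>) \<ominus> \<alpha> = \<alpha>"
proof -
  note t = squares_tside[OF assms] and v = squares_Ver[OF assms]
  have "sq_vid D (tside D \<alpha>) \<in> squares D (vid D (vdom D j)) (vid D (vdom D k))"
    using sq_vid_closed[OF t(1)] t by simp
  \<comment> \<open>Strict vertical units put the composite back between \<open>j\<close> and
    \<open>k\<close>, so the horizontal identities in the naturality equation cancel.\<close>
  then have "sq_vid D (tside D \<alpha>) \<ominus> \<alpha> \<in> squares D j k"
    using squares_vcomp(1)[OF _ assms] sq_vid_closed[OF t(1)] vcomp_vid v by metis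
  then show ?thesis
    using vlunit_natural[of \<alpha>] vlunit_identity v assms squares_hcomp_unit
    by (metis squares_iff)
qed

lemma vcomp_sq_vid:
  assumes "\<alpha> \<in> squares D j k"
  shows "\<alpha> \<ominus> sq_vid D (bside D \<alpha>) = \<alpha>"
proof -
  note t = squares_bside[OF assms] and v = squares_Ver[OF assms]
  have "sq_vid D (bside D \<alpha>) \<in> squares D (vid D (vcod D j)) (vid D (vcod D k))"
    using sq_vid_closed[OF t(1)] t by simp
  then have "\<alpha> \<ominus> sq_vid D (bside D \<alpha>) \<in> squares D j k"
    using squares_vcomp(1)[OF assms] sq_vid_closed[OF t(1)] vcomp_vid v by metis
  then show ?thesis
    using vrunit_natural[of \<alpha>] vrunit_identity v assms squares_hcomp_unit
    by (metis squares_iff)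
qed

end

lemma (in strict_double_functor) squares_on_sq:
  "\<alpha> \<in> squares X j k \<Longrightarrow> on_sq F \<alpha> \<in> squares A (on_ver F j) (on_ver F k)"
  using on_sq by (auto simp: squares_iff)

locale opposite_double_functors =
  A: normal_vertically_weak_double_category A +
  X: normal_vertically_weak_double_category X +
  F: strict_double_functor X A F +
  G: strict_double_functor A X G
  for X :: "('o, 'h, 'v, 's) double_cat"
    and A :: "('p, 'i, 'w, 't) double_cat"
    and F :: "('o, 'h, 'v, 's, 'p, 'i, 'w, 't) double_map"
    and G :: "('p, 'i, 'w, 't, 'o, 'h, 'v, 's) double_map"

section \<open>From a unit and a counit to compatible bijections\<close>

locale double_adjunction = opposite_double_functors +
  H: strict_horizontal_transformation X X id_map "G \<circ>\<^sub>d F" \<eta>o \<eta>v +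
  E: strict_horizontal_transformation A A "F \<circ>\<^sub>d G" id_map \<epsilon>o \<epsilon>v
  for \<eta>o \<eta>v \<epsilon>o \<epsilon>v +
  assumes triangles: "triangle_identities X A F G \<eta>o \<eta>v \<epsilon>o \<epsilon>v"
begin

definition transpose where
  "transpose j k \<alpha> = \<eta>v j \<parallel>\<^bsub>X\<^esub> on_sq G \<alpha>"

lemma unit_in_squares: "j \<in> Ver X \<Longrightarrow> \<eta>v j \<in> squares X j (on_ver G (on_ver F j))"
  using H.comp_ver by (auto simp: id_map_def comp_map_def)

lemma counit_in_squares: "k \<in> Ver A \<Longrightarrow> \<epsilon>v k \<in> squares A (on_ver F (on_ver G k)) k"
  using E.comp_ver by (auto simp: id_map_def comp_map_def)

lemma unit_natural:
  "\<sigma> \<in> squares X j k \<Longrightarrow> \<sigma> \<parallel>\<^bsub>X\<^esub> \<eta>v k = \<eta>v j \<parallel>\<^bsub>X\<^esub> on_sq G (on_sq F \<sigma>)"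
  using H.naturality[of \<sigma>] by (auto simp: id_map_def comp_map_def squares_iff)

lemma counit_natural:
  "\<tau> \<in> squares A j k \<Longrightarrow> on_sq F (on_sq G \<tau>) \<parallel>\<^bsub>A\<^esub> \<epsilon>v k = \<epsilon>v j \<parallel>\<^bsub>A\<^esub> \<tau>"
  using E.naturality[of \<tau>] by (auto simp: id_map_def comp_map_def squares_iff)

lemma F_hcomp:
  "\<lbrakk>\<alpha> \<in> squares X j k; \<beta> \<in> squares X k l\<rbrakk> \<Longrightarrow> on_sq F (\<alpha> \<parallel>\<^bsub>X\<^esub> \<beta>) = on_sq F \<alpha> \<parallel>\<^bsub>A\<^esub> on_sq F \<beta>"
  using F.pres_sq_hcomp by (auto simp: squares_iff)

lemma G_hcomp:
  "\<lbrakk>\<alpha> \<in> squares A j k; \<beta> \<in> squares A k l\<rbrakk> \<Longrightarrow> on_sq G (\<alpha> \<parallel>\<^bsub>A\<^esub> \<beta>) = on_sq G \<alpha> \<parallel>\<^bsub>X\<^esub> on_sq G \<beta>"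
  using G.pres_sq_hcomp by (auto simp: squares_iff)

text \<open>In either round trip, naturality of \<open>\<epsilon>v\<close> or \<open>\<eta>v\<close>
  moves the given square to the outside, and what remains is the left side of a triangle
  identity.\<close>

lemma bij_betw_transpose:
  assumes j: "j \<in> Ver X" and k: "k \<in> Ver A"
  shows "bij_betw (transpose j k) (squares A (on_ver F j) k) (squares X j (on_ver G k))"
proof (rule bij_betw_byWitness[where f' = "\<lambda>\<beta>. on_sq F \<beta> \<parallel>\<^bsub>A\<^esub> \<epsilon>v k"])
  note \<eta> = unit_in_squares[OF j] and \<epsilon> = counit_in_squares[OF k]
  have "on_sq F (\<eta>v j \<parallel>\<^bsub>X\<^esub> on_sq G \<alpha>) \<parallel>\<^bsub>A\<^esub> \<epsilon>v k = \<alpha>" if \<alpha>: "\<alpha> \<in> squares A (on_ver F j) k" for \<alpha>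
  proof -
    note G\<alpha> = G.squares_on_sq[OF \<alpha>]
    note \<epsilon>F = counit_in_squares[OF A.squares_Ver(1)[OF \<alpha>]]
    have "on_sq F (\<eta>v j \<parallel>\<^bsub>X\<^esub> on_sq G \<alpha>) \<parallel>\<^bsub>A\<^esub> \<epsilon>v k
        = on_sq F (\<eta>v j) \<parallel>\<^bsub>A\<^esub> (on_sq F (on_sq G \<alpha>) \<parallel>\<^bsub>A\<^esub> \<epsilon>v k)"
      using F_hcomp[OF \<eta> G\<alpha>]
        A.squares_hcomp_assoc[OF F.squares_on_sq[OF \<eta>] F.squares_on_sq[OF G\<alpha>] \<epsilon>] by simp
    also have "\<dots> = (on_sq F (\<eta>v j) \<parallel>\<^bsub>A\<^esub> \<epsilon>v (on_ver F j)) \<parallel>\<^bsub>A\<^esub> \<alpha>"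
      using counit_natural[OF \<alpha>] A.squares_hcomp_assoc[OF F.squares_on_sq[OF \<eta>] \<epsilon>F \<alpha>] by simp
    also have "\<dots> = \<alpha>"
      using triangles j A.squares_hcomp_unit[OF \<alpha>] by (simp add: triangle_identities_def)
    finally show ?thesis .
  qed
  then show "\<forall>\<alpha> \<in> squares A (on_ver F j) k. on_sq F (transpose j k \<alpha>) \<parallel>\<^bsub>A\<^esub> \<epsilon>v k = \<alpha>"
    by (simp add: transpose_def)
  have "\<eta>v j \<parallel>\<^bsub>X\<^esub> on_sq G (on_sq F \<beta> \<parallel>\<^bsub>A\<^esub> \<epsilon>v k) = \<beta>" if \<beta>: "\<beta> \<in> squares X j (on_ver G k)" for \<beta>
  proof -
    note F\<beta> = F.squares_on_sq[OF \<beta>]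
    note \<eta>G = unit_in_squares[OF X.squares_Ver(2)[OF \<beta>]]
    have "\<eta>v j \<parallel>\<^bsub>X\<^esub> on_sq G (on_sq F \<beta> \<parallel>\<^bsub>A\<^esub> \<epsilon>v k)
        = (\<eta>v j \<parallel>\<^bsub>X\<^esub> on_sq G (on_sq F \<beta>)) \<parallel>\<^bsub>X\<^esub> on_sq G (\<epsilon>v k)"
      using G_hcomp[OF F\<beta> \<epsilon>]
        X.squares_hcomp_assoc[OF \<eta> G.squares_on_sq[OF F\<beta>] G.squares_on_sq[OF \<epsilon>]] by simp
    also have "\<dots> = \<beta> \<parallel>\<^bsub>X\<^esub> (\<eta>v (on_ver G k) \<parallel>\<^bsub>X\<^esub> on_sq G (\<epsilon>v k))"
      using unit_natural[OF \<beta>] X.squares_hcomp_assoc[OF \<beta> \<eta>G G.squares_on_sq[OF \<epsilon>]] by simp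
    also have "\<dots> = \<beta>"
      using triangles k X.squares_hcomp_unit[OF \<beta>] by (simp add: triangle_identities_def)
    finally show ?thesis .
  qed
  then show "\<forall>\<beta> \<in> squares X j (on_ver G k). transpose j k (on_sq F \<beta> \<parallel>\<^bsub>A\<^esub> \<epsilon>v k) = \<beta>"
    by (simp add: transpose_def)
  show "transpose j k ` squares A (on_ver F j) k \<subseteq> squares X j (on_ver G k)"
    using X.squares_hcomp[OF \<eta> G.squares_on_sq] by (auto simp: transpose_def)
  show "(\<lambda>\<beta>. on_sq F \<beta> \<parallel>\<^bsub>A\<^esub> \<epsilon>v k) ` squares X j (on_ver G k) \<subseteq> squares A (on_ver F j) k"
    using A.squares_hcomp[OF F.squares_on_sq \<epsilon>] by auto
qed

text \<open>Naturality of \<open>\<eta>v\<close> at \<sigma> exchanges \<sigma> with its image under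
  \<open>G \<circ>\<^sub>d F\<close>.\<close>

lemma natural_in_left_transpose: "natural_in_left X A F transpose"
  unfolding natural_in_left_def transpose_def
proof (intro ballI)
  fix j' j k \<sigma> \<alpha>
  assume j': "j' \<in> Ver X" and j: "j \<in> Ver X"
    and \<sigma>: "\<sigma> \<in> squares X j' j" and \<alpha>: "\<alpha> \<in> squares A (on_ver F j) k"
  note F\<sigma> = F.squares_on_sq[OF \<sigma>]
  show "\<eta>v j' \<parallel>\<^bsub>X\<^esub> on_sq G (on_sq F \<sigma> \<parallel>\<^bsub>A\<^esub> \<alpha>) = \<sigma> \<parallel>\<^bsub>X\<^esub> (\<eta>v j \<parallel>\<^bsub>X\<^esub> on_sq G \<alpha>)"
    using G_hcomp[OF F\<sigma> \<alpha>] unit_natural[OF \<sigma>]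
      X.squares_hcomp_assoc[OF unit_in_squares[OF j'] G.squares_on_sq[OF F\<sigma>] G.squares_on_sq[OF \<alpha>]]
      X.squares_hcomp_assoc[OF \<sigma> unit_in_squares[OF j] G.squares_on_sq[OF \<alpha>]]
    by simp
qed

lemma natural_in_right_transpose: "natural_in_right X A F G transpose"
  unfolding natural_in_right_def transpose_def
  using G_hcomp X.squares_hcomp_assoc[OF unit_in_squares G.squares_on_sq G.squares_on_sq]
  by simp

text \<open>Both \<open>\<eta>v\<close> and \<open>G\<close> respect vertical composition, so the
  claim is an instance of the interchange law.\<close>

lemma vertically_compatible_transpose: "vertically_compatible X A F transpose"
  unfolding vertically_compatible_def
proof (intro ballI impI, elim conjE)
  fix j\<^sub>1 j\<^sub>2 k\<^sub>1 k\<^sub>2 \<alpha> \<beta>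
  assume j: "j\<^sub>1 \<in> Ver X" "j\<^sub>2 \<in> Ver X"
    and \<alpha>: "\<alpha> \<in> squares A (on_ver F j\<^sub>1) k\<^sub>1" and \<beta>: "\<beta> \<in> squares A (on_ver F j\<^sub>2) k\<^sub>2"
    and c: "vcod X j\<^sub>1 = vdom X j\<^sub>2" "bside A \<alpha> = tside A \<beta>"
  note \<eta> = unit_in_squares[OF j(1)] unit_in_squares[OF j(2)]
  note G\<alpha> = G.squares_on_sq[OF \<alpha>] and G\<beta> = G.squares_on_sq[OF \<beta>]
  have \<eta>_sides: "bside X (\<eta>v j\<^sub>1) = tside X (\<eta>v j\<^sub>2)"
    using H.comp_ver j c by simp
  have G_sides: "bside X (on_sq G \<alpha>) = tside X (on_sq G \<beta>)"
    using G.on_sq \<alpha> \<beta> c by (simp add: squares_iff)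
  have "\<eta>v (j\<^sub>1 \<bullet>\<^bsub>X\<^esub> j\<^sub>2) \<parallel>\<^bsub>X\<^esub> on_sq G (\<alpha> \<ominus>\<^bsub>A\<^esub> \<beta>)
      = (\<eta>v j\<^sub>1 \<ominus>\<^bsub>X\<^esub> \<eta>v j\<^sub>2) \<parallel>\<^bsub>X\<^esub> (on_sq G \<alpha> \<ominus>\<^bsub>X\<^esub> on_sq G \<beta>)"
    using H.comp_vcomp[OF j c(1)] G.pres_sq_vcomp[of \<alpha> \<beta>] \<alpha> \<beta> c by (simp add: squares_iff)
  also have "\<dots> = (\<eta>v j\<^sub>1 \<parallel>\<^bsub>X\<^esub> on_sq G \<alpha>) \<ominus>\<^bsub>X\<^esub> (\<eta>v j\<^sub>2 \<parallel>\<^bsub>X\<^esub> on_sq G \<beta>)"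
    by (rule X.interchange[symmetric]) (use \<eta> G\<alpha> G\<beta> \<eta>_sides G_sides in \<open>simp_all add: squares_iff\<close>)
  finally show "bside X (transpose j\<^sub>1 k\<^sub>1 \<alpha>) = tside X (transpose j\<^sub>2 k\<^sub>2 \<beta>) \<and>
      transpose (j\<^sub>1 \<bullet>\<^bsub>X\<^esub> j\<^sub>2) (k\<^sub>1 \<bullet>\<^bsub>A\<^esub> k\<^sub>2) (\<alpha> \<ominus>\<^bsub>A\<^esub> \<beta>)
        = transpose j\<^sub>1 k\<^sub>1 \<alpha> \<ominus>\<^bsub>X\<^esub> transpose j\<^sub>2 k\<^sub>2 \<beta>"
    using X.squares_hcomp_sides[OF \<eta>(1) G\<alpha>] X.squares_hcomp_sides[OF \<eta>(2) G\<beta>] \<eta>_sides G_sides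
    by (simp add: transpose_def)
qed

end

section \<open>From compatible bijections to a unit and a counit\<close>

locale compatible_transposition = opposite_double_functors +
  fixes \<phi>
  assumes bij_\<phi>: "\<lbrakk>j \<in> Ver X; k \<in> Ver A\<rbrakk> \<Longrightarrow>
      bij_betw (\<phi> j k) (squares A (on_ver F j) k) (squares X j (on_ver G k))"
    and natural_left: "natural_in_left X A F \<phi>"
    and natural_right: "natural_in_right X A F G \<phi>"
    and vertical: "vertically_compatible X A F \<phi>"
begin

definition unit where
  "unit j = \<phi> j (on_ver F j) (sq_hid A (on_ver F j))"

definition counit where
  "counit k = the_inv_into (squares A (on_ver F (on_ver G k)) k) (\<phi> (on_ver G k) k)
     (sq_hid X (on_ver G k))"

text \<open>The bijections speak only of squares, so the component at an object has to be read off
  from a side of the unit at its vertical identity. Choosing the top is harmless: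
  \<open>unit_sides\<close> shows that the bottom agrees.\<close>

definition unit_obj where
  "unit_obj B = tside X (unit (vid X B))"

definition counit_obj where
  "counit_obj C = tside A (counit (vid A C))"

lemma \<phi>_in_squares:
  "\<lbrakk>j \<in> Ver X; \<alpha> \<in> squares A (on_ver F j) k\<rbrakk> \<Longrightarrow> \<phi> j k \<alpha> \<in> squares X j (on_ver G k)"
  using bij_\<phi> A.squares_Ver by (metis bij_betwE)

lemma \<phi>_inject:
  "\<lbrakk>j \<in> Ver X; \<alpha> \<in> squares A (on_ver F j) k; \<beta> \<in> squares A (on_ver F j) k; \<phi> j k \<alpha> = \<phi> j k \<beta>\<rbrakk>
   \<Longrightarrow> \<alpha> = \<beta>"
  using bij_\<phi> A.squares_Ver by (metis bij_betw_imp_inj_on inj_onD)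

lemma \<phi>_left:
  assumes "\<sigma> \<in> squares X j' j" "\<alpha> \<in> squares A (on_ver F j) k"
  shows "\<phi> j' k (on_sq F \<sigma> \<parallel>\<^bsub>A\<^esub> \<alpha>) = \<sigma> \<parallel>\<^bsub>X\<^esub> \<phi> j k \<alpha>"
  using assms natural_left X.squares_Ver[OF assms(1)] A.squares_Ver[OF assms(2)]
  by (simp add: natural_in_left_def)

lemma \<phi>_right:
  assumes "j \<in> Ver X" "\<alpha> \<in> squares A (on_ver F j) k" "\<tau> \<in> squares A k k'"
  shows "\<phi> j k' (\<alpha> \<parallel>\<^bsub>A\<^esub> \<tau>) = \<phi> j k \<alpha> \<parallel>\<^bsub>X\<^esub> on_sq G \<tau>"
  using assms natural_right A.squares_Ver[OF assms(2)] A.squares_Ver[OF assms(3)]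
  by (simp add: natural_in_right_def)

text \<open>Matching sides of \<alpha> and \<beta> make \<open>k\<^sub>1\<close> and
  \<open>k\<^sub>2\<close> composable, but on the other side they only make the images of
  \<open>j\<^sub>1\<close> and \<open>j\<^sub>2\<close> under \<open>F\<close> composable. As
  \<open>F\<close> may identify objects, composability of \<open>j\<^sub>1\<close> and
  \<open>j\<^sub>2\<close> is a separate assumption.\<close>

lemma \<phi>_vcomp:
  assumes "j\<^sub>1 \<in> Ver X" "j\<^sub>2 \<in> Ver X" "vcod X j\<^sub>1 = vdom X j\<^sub>2"
    and "\<alpha> \<in> squares A (on_ver F j\<^sub>1) k\<^sub>1" "\<beta> \<in> squares A (on_ver F j\<^sub>2) k\<^sub>2"
    and "bside A \<alpha> = tside A \<beta>"
  shows "bside X (\<phi> j\<^sub>1 k\<^sub>1 \<alpha>) = tside X (\<phi> j\<^sub>2 k\<^sub>2 \<beta>)"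
    and "\<phi> (j\<^sub>1 \<bullet>\<^bsub>X\<^esub> j\<^sub>2) (k\<^sub>1 \<bullet>\<^bsub>A\<^esub> k\<^sub>2) (\<alpha> \<ominus>\<^bsub>A\<^esub> \<beta>) = \<phi> j\<^sub>1 k\<^sub>1 \<alpha> \<ominus>\<^bsub>X\<^esub> \<phi> j\<^sub>2 k\<^sub>2 \<beta>"
  using assms vertical A.squares_Ver[OF assms(4)] A.squares_Ver[OF assms(5)]
    A.squares_vcomp_vcod[OF assms(4-6)]
  unfolding vertically_compatible_def by blast+

lemma F_hid: "j \<in> Ver X \<Longrightarrow> sq_hid A (on_ver F j) \<in> squares A (on_ver F j) (on_ver F j)"
  using F.on_ver A.sq_hid_in_squares by blast

lemma G_hid: "k \<in> Ver A \<Longrightarrow> sq_hid X (on_ver G k) \<in> squares X (on_ver G k) (on_ver G k)"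
  using G.on_ver X.sq_hid_in_squares by blast

lemma unit_in_squares: "j \<in> Ver X \<Longrightarrow> unit j \<in> squares X j (on_ver G (on_ver F j))"
  using \<phi>_in_squares F_hid by (simp add: unit_def)

lemma counit_in_squares: "k \<in> Ver A \<Longrightarrow> counit k \<in> squares A (on_ver F (on_ver G k)) k"
  and \<phi>_counit: "k \<in> Ver A \<Longrightarrow> \<phi> (on_ver G k) k (counit k) = sq_hid X (on_ver G k)"
proof -
  assume k: "k \<in> Ver A"
  then have b: "bij_betw (\<phi> (on_ver G k) k) (squares A (on_ver F (on_ver G k)) k)
      (squares X (on_ver G k) (on_ver G k))"
    using bij_\<phi> G.on_ver by blast
  show "counit k \<in> squares A (on_ver F (on_ver G k)) k"
    using bij_betwE[OF bij_betw_the_inv_into[OF b]] G_hid[OF k] by (simp add: counit_def)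
  show "\<phi> (on_ver G k) k (counit k) = sq_hid X (on_ver G k)"
    using f_the_inv_into_f_bij_betw[OF b] G_hid[OF k] by (simp add: counit_def)
qed

text \<open>Yoneda argument: \<alpha> is the identity square at \<open>on_ver F j\<close> followed
  by \<alpha>, and naturality in \<open>k\<close> takes \<alpha> out of \<phi>.\<close>

lemma \<phi>_eq_unit_hcomp:
  assumes "j \<in> Ver X" "\<alpha> \<in> squares A (on_ver F j) k"
  shows "\<phi> j k \<alpha> = unit j \<parallel>\<^bsub>X\<^esub> on_sq G \<alpha>"
  using \<phi>_right[OF assms(1) F_hid[OF assms(1)] assms(2)] A.squares_hcomp_unit[OF assms(2)]
  by (simp add: unit_def)

lemma counit_triangle:
  "k \<in> Ver A \<Longrightarrow> unit (on_ver G k) \<parallel>\<^bsub>X\<^esub> on_sq G (counit k) = sq_hid X (on_ver G k)"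
  using \<phi>_eq_unit_hcomp counit_in_squares \<phi>_counit G.on_ver by simp

text \<open>By naturality in \<open>j\<close>, both sides are sent by \<phi> to
  \<open>unit j\<close>; injectivity does the rest.\<close>

lemma unit_triangle:
  assumes j: "j \<in> Ver X"
  shows "on_sq F (unit j) \<parallel>\<^bsub>A\<^esub> counit (on_ver F j) = sq_hid A (on_ver F j)"
proof (rule \<phi>_inject[OF j])
  have Fj: "on_ver F j \<in> Ver A" using F.on_ver j by blast
  note u = unit_in_squares[OF j] and c = counit_in_squares[OF Fj]
  show "on_sq F (unit j) \<parallel>\<^bsub>A\<^esub> counit (on_ver F j) \<in> squares A (on_ver F j) (on_ver F j)"
    using A.squares_hcomp[OF F.squares_on_sq[OF u] c] .
  show "sq_hid A (on_ver F j) \<in> squares A (on_ver F j) (on_ver F j)"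
    by (rule F_hid[OF j])
  show "\<phi> j (on_ver F j) (on_sq F (unit j) \<parallel>\<^bsub>A\<^esub> counit (on_ver F j))
      = \<phi> j (on_ver F j) (sq_hid A (on_ver F j))"
    using \<phi>_left[OF u c] \<phi>_counit[OF Fj] X.squares_hcomp_unit[OF u] by (simp add: unit_def)
qed

section \<open>Sides and vertical composites of the unit\<close>

text \<open>Horizontal identity squares at composable vertical morphisms are themselves vertically
  composable, so compatibility of \<phi> applies to them.\<close>

lemma unit_composable:
  assumes "j\<^sub>1 \<in> Ver X" "j\<^sub>2 \<in> Ver X" "vcod X j\<^sub>1 = vdom X j\<^sub>2"
  shows "bside X (unit j\<^sub>1) = tside X (unit j\<^sub>2)"
    and "unit (j\<^sub>1 \<bullet>\<^bsub>X\<^esub> j\<^sub>2) = unit j\<^sub>1 \<ominus>\<^bsub>X\<^esub> unit j\<^sub>2"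
proof -
  have v: "on_ver F j\<^sub>1 \<in> Ver A" "on_ver F j\<^sub>2 \<in> Ver A"
    "vcod A (on_ver F j\<^sub>1) = vdom A (on_ver F j\<^sub>2)"
    using F.on_ver assms by simp_all
  have s: "bside A (sq_hid A (on_ver F j\<^sub>1)) = tside A (sq_hid A (on_ver F j\<^sub>2))"
    using A.sq_hid_sides v by simp
  note c = \<phi>_vcomp[OF assms F_hid[OF assms(1)] F_hid[OF assms(2)] s]
  show "bside X (unit j\<^sub>1) = tside X (unit j\<^sub>2)"
    using c(1) by (simp add: unit_def)
  show "unit (j\<^sub>1 \<bullet>\<^bsub>X\<^esub> j\<^sub>2) = unit j\<^sub>1 \<ominus>\<^bsub>X\<^esub> unit j\<^sub>2"
    using c(2) F.pres_vcomp[OF assms] A.sq_hid_vcomp[OF v] by (simp add: unit_def)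
qed

lemma unit_sides:
  assumes "j \<in> Ver X"
  shows "tside X (unit j) = unit_obj (vdom X j)" "bside X (unit j) = unit_obj (vcod X j)"
proof -
  have v: "vdom X j \<in> Obj X" "vcod X j \<in> Obj X" using X.ver_closed assms by blast+
  note d = X.vid_closed[OF v(1)] and c = X.vid_closed[OF v(2)]
  \<comment> \<open>A vertical identity is composable with itself, hence its unit square has equal
    top and bottom.\<close>
  have "bside X (unit (vid X (vdom X j))) = tside X (unit (vid X (vdom X j)))"
    using unit_composable(1) d by simp
  then show "tside X (unit j) = unit_obj (vdom X j)"
    using unit_composable(1)[OF _ assms] d by (simp add: unit_obj_def)
  show "bside X (unit j) = unit_obj (vcod X j)"
    using unit_composable(1)[OF assms] c by (simp add: unit_obj_def)
qed

section \<open>Sides of the counit and components at vertical identities\<close>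

lemma on_ver_FG_vid: "C \<in> Obj A \<Longrightarrow> on_ver F (on_ver G (vid A C)) = vid A (on_obj F (on_obj G C))"
  using G.pres_vid G.on_obj F.pres_vid by simp

lemma sq_vid_in_squares:
  assumes "g \<in> Hor A" "hdom A g = on_obj F (on_obj G C)" "hcod A g = C"
  shows "sq_vid A g \<in> squares A (on_ver F (on_ver G (vid A C))) (vid A C)"
  using A.sq_vid_closed[OF assms(1)] A.hor_closed[OF assms(1)] assms on_ver_FG_vid by auto

lemma counit_tside_hor:
  assumes "k \<in> Ver A"
  shows "tside A (counit k) \<in> Hor A" "hdom A (tside A (counit k)) = on_obj F (on_obj G (vdom A k))"
    "hcod A (tside A (counit k)) = vdom A k"
  using A.squares_tside[OF counit_in_squares[OF assms]] F.on_ver G.on_ver assms by simp_all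

lemma counit_bside_hor:
  assumes "k \<in> Ver A"
  shows "bside A (counit k) \<in> Hor A" "hdom A (bside A (counit k)) = on_obj F (on_obj G (vcod A k))"
    "hcod A (bside A (counit k)) = vcod A k"
  using A.squares_bside[OF counit_in_squares[OF assms]] F.on_ver G.on_ver assms by simp_all

text \<open>Compatibility carries matching sides from \<open>A\<close> to \<open>X\<close> but not
  back, so the argument of \<open>unit_sides\<close> does not transfer to the counit. Instead, the
  vertical identity square on the top of \<open>counit k\<close> is stacked above it; the bottom of
  its image then equals the top of the image of \<open>counit k\<close>, a horizontal
  identity.\<close>

lemma \<phi>_sq_vid_tside_counit:
  assumes k: "k \<in> Ver A"
  defines "C \<equiv> vdom A k"
  shows "bside X (\<phi> (on_ver G (vid A C)) (vid A C) (sq_vid A (tside A (counit k))))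
    = hid X (on_obj G C)"
proof -
  have C: "C \<in> Obj A" using A.ver_closed k by (simp add: C_def)
  have v: "vid A C \<in> Ver A" "on_ver G (vid A C) \<in> Ver X" "on_ver G k \<in> Ver X"
    "vcod X (on_ver G (vid A C)) = vdom X (on_ver G k)"
    using A.vid_closed[OF C] G.on_ver k by (simp_all add: C_def)
  note t = counit_tside_hor[OF k, folded C_def]
  show ?thesis
    using \<phi>_vcomp(1)[OF v(2-4) sq_vid_in_squares[OF t] counit_in_squares[OF k]]
      A.sq_vid_closed[OF t(1)] \<phi>_counit[OF k] X.sq_hid_sides[OF v(3)] G.on_ver[OF k]
    by (simp add: C_def)
qed

lemma \<phi>_sq_vid_bside_counit:
  assumes k: "k \<in> Ver A"
  defines "C \<equiv> vcod A k"
  shows "tside X (\<phi> (on_ver G (vid A C)) (vid A C) (sq_vid A (bside A (counit k))))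
    = hid X (on_obj G C)"
proof -
  have C: "C \<in> Obj A" using A.ver_closed k by (simp add: C_def)
  have v: "vid A C \<in> Ver A" "on_ver G k \<in> Ver X" "on_ver G (vid A C) \<in> Ver X"
    "vcod X (on_ver G k) = vdom X (on_ver G (vid A C))"
    using A.vid_closed[OF C] G.on_ver k by (simp_all add: C_def)
  note t = counit_bside_hor[OF k, folded C_def]
  show ?thesis
    using \<phi>_vcomp(1)[OF v(2-4) counit_in_squares[OF k] sq_vid_in_squares[OF t]]
      A.sq_vid_closed[OF t(1)] \<phi>_counit[OF k] X.sq_hid_sides[OF v(2)] G.on_ver[OF k]
    by (simp add: C_def)
qed

text \<open>Stacking the vertical identity square on its top side above the counit changes nothing.
  After applying \<phi> the counit becomes a vertical unit and drops out, so both squares have the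
  same image.\<close>

lemma counit_vid:
  assumes C: "C \<in> Obj A"
  shows "counit (vid A C) = sq_vid A (counit_obj C)"
proof -
  define u where "u = vid A C"
  have u: "u \<in> Ver A" "vdom A u = C" "vcod A u = C" using A.vid_closed[OF C] by (simp_all add: u_def)
  have Gu: "on_ver G u \<in> Ver X" "vdom X (on_ver G u) = on_obj G C" "vcod X (on_ver G u) = on_obj G C"
    using G.on_ver u by simp_all
  have Gu_vid: "on_ver G u = vid X (on_obj G C)"
    using G.pres_vid[OF C] by (simp add: u_def)
  define g where "g = tside A (counit u)"
  note t = counit_tside_hor[OF u(1), folded g_def, unfolded u(2)]
  have g: "sq_vid A g \<in> squares A (on_ver F (on_ver G u)) u"
    using sq_vid_in_squares[OF t] by (simp add: u_def)
  note c = counit_in_squares[OF u(1)]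
  have gc: "sq_vid A g \<ominus>\<^bsub>A\<^esub> counit u = counit u"
    using A.sq_vid_vcomp[OF c] by (simp add: g_def)
  have uu: "u \<bullet>\<^bsub>A\<^esub> u = u" using A.vcomp_vid[OF u(1)] u by (simp add: u_def)
  have GuGu: "on_ver G u \<bullet>\<^bsub>X\<^esub> on_ver G u = on_ver G u"
    using X.vcomp_vid[OF Gu(1)] Gu Gu_vid by simp
  have b: "bside X (\<phi> (on_ver G u) u (sq_vid A g)) = hid X (on_obj G C)"
    using \<phi>_sq_vid_tside_counit[OF u(1)] by (simp add: u(2) g_def u_def[symmetric])
  \<comment> \<open>At a vertical identity the horizontal identity square is also a vertical
    identity square, which lets it cancel below a square with bottom
    \<open>hid X (on_obj G C)\<close>.\<close>
  have h: "sq_hid X (on_ver G u) = sq_vid X (hid X (on_obj G C))"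
    using X.sq_vid_hid G.on_obj[OF C] Gu_vid by simp
  have "sq_hid X (on_ver G u) = \<phi> (on_ver G u) u (sq_vid A g \<ominus>\<^bsub>A\<^esub> counit u)"
    using gc \<phi>_counit[OF u(1)] by simp
  also have "\<dots> = \<phi> (on_ver G u) u (sq_vid A g) \<ominus>\<^bsub>X\<^esub> sq_hid X (on_ver G u)"
    using \<phi>_vcomp(2)[OF Gu(1) Gu(1) _ g c] Gu A.sq_vid_closed[OF t(1)] \<phi>_counit[OF u(1)] uu GuGu
    by (simp add: g_def)
  also have "\<dots> = \<phi> (on_ver G u) u (sq_vid A g)"
    using X.vcomp_sq_vid[OF \<phi>_in_squares[OF Gu(1) g]] b h by simp
  finally have "\<phi> (on_ver G u) u (counit u) = \<phi> (on_ver G u) u (sq_vid A g)"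
    using \<phi>_counit[OF u(1)] by simp
  then have "counit u = sq_vid A g"
    using \<phi>_inject[OF Gu(1) c g] by simp
  then show ?thesis by (simp add: g_def u_def counit_obj_def)
qed

lemma unit_obj_hor:
  assumes B: "B \<in> Obj X"
  shows "unit_obj B \<in> Hor X" "hdom X (unit_obj B) = B"
    "hcod X (unit_obj B) = on_obj G (on_obj F B)"
  using X.squares_tside[OF unit_in_squares, of "vid X B"] X.vid_closed[OF B] F.on_ver G.on_ver
  by (simp_all add: unit_obj_def)

lemma counit_obj_hor:
  assumes "C \<in> Obj A"
  shows "counit_obj C \<in> Hor A" "hdom A (counit_obj C) = on_obj F (on_obj G C)"
    "hcod A (counit_obj C) = C"
  using counit_tside_hor[of "vid A C"] A.vid_closed[OF assms] by (simp_all add: counit_obj_def)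

text \<open>This compares the top sides in the triangle identity for squares at the vertical
  identity of \<open>B\<close>.\<close>

lemma unit_triangle_obj:
  assumes B: "B \<in> Obj X"
  shows "on_hor F (unit_obj B) \<cdot>\<^bsub>A\<^esub> counit_obj (on_obj F B) = hid A (on_obj F B)"
proof -
  have u: "vid X B \<in> Ver X" "vdom X (vid X B) = B" using X.vid_closed[OF B] by auto
  have Fu: "on_ver F (vid X B) \<in> Ver A" "vdom A (on_ver F (vid X B)) = on_obj F B"
    using F.on_ver u by auto
  note s = unit_in_squares[OF u(1)]
  have "tside A (on_sq F (unit (vid X B)) \<parallel>\<^bsub>A\<^esub> counit (on_ver F (vid X B))) = hid A (on_obj F B)"
    using unit_triangle[OF u(1)] A.sq_hid_sides[OF Fu(1)] Fu by simp
  then show ?thesis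
    using A.squares_hcomp_sides(1)[OF F.squares_on_sq[OF s] counit_in_squares[OF Fu(1)]]
      F.on_sq[of "unit (vid X B)"] s F.pres_vid[OF B]
    by (simp add: squares_iff unit_obj_def counit_obj_def)
qed

lemma counit_triangle_obj:
  assumes C: "C \<in> Obj A"
  shows "unit_obj (on_obj G C) \<cdot>\<^bsub>X\<^esub> on_hor G (counit_obj C) = hid X (on_obj G C)"
proof -
  have u: "vid A C \<in> Ver A" "vdom A (vid A C) = C" using A.vid_closed[OF C] by auto
  have Gu: "on_ver G (vid A C) \<in> Ver X" "vdom X (on_ver G (vid A C)) = on_obj G C"
    using G.on_ver u by auto
  note s = counit_in_squares[OF u(1)]
  have "tside X (unit (on_ver G (vid A C)) \<parallel>\<^bsub>X\<^esub> on_sq G (counit (vid A C))) = hid X (on_obj G C)"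
    using counit_triangle[OF u(1)] X.sq_hid_sides[OF Gu(1)] Gu by simp
  then show ?thesis
    using X.squares_hcomp_sides(1)[OF unit_in_squares[OF Gu(1)] G.squares_on_sq[OF s]]
      G.on_sq[of "counit (vid A C)"] s G.pres_vid[OF C]
    by (simp add: squares_iff unit_obj_def counit_obj_def)
qed

text \<open>The triangle identity on objects factors the horizontal identity at
  \<open>on_obj F B\<close>. Passing to vertical identity squares, and using
  \<open>counit_vid\<close>, the square defining the unit becomes the image under \<open>F\<close>
  of \<open>sq_vid X a\<close> followed by a counit; \<phi> sends this to
  \<open>sq_vid X a\<close>.\<close>

lemma unit_vid:
  assumes B: "B \<in> Obj X"
  shows "unit (vid X B) = sq_vid X (unit_obj B)"
proof -
  define a C where "a = unit_obj B" and "C = on_obj F B"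
  have C: "C \<in> Obj A" using F.on_obj[OF B] by (simp add: C_def)
  have u: "vid A C \<in> Ver A" using A.vid_closed[OF C] by simp
  note a = unit_obj_hor[OF B, folded a_def C_def] and e = counit_obj_hor[OF C]
  have sa: "sq_vid X a \<in> squares X (vid X B) (on_ver G (vid A C))"
    using X.sq_vid_closed[OF a(1)] a G.pres_vid[OF C] by simp
  have Fa: "on_hor F a \<in> Hor A" "hcod A (on_hor F a) = hdom A (counit_obj C)"
    using F.on_hor[OF a(1)] a e by simp_all
  have Fu: "on_ver F (vid X B) = vid A C" using F.pres_vid[OF B] by (simp add: C_def)
  have "unit (vid X B) = \<phi> (vid X B) (vid A C) (sq_vid A (on_hor F a \<cdot>\<^bsub>A\<^esub> counit_obj C))"
    using unit_triangle_obj[OF B] Fu A.sq_vid_hid[OF C] by (simp add: unit_def a_def C_def)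
  also have "\<dots> = \<phi> (vid X B) (vid A C) (on_sq F (sq_vid X a) \<parallel>\<^bsub>A\<^esub> counit (vid A C))"
    using A.sq_vid_hcomp[OF Fa(1) e(1) Fa(2)] F.pres_sq_vid[OF a(1)] counit_vid[OF C] by simp
  also have "\<dots> = sq_vid X a"
    using \<phi>_left[OF sa counit_in_squares[OF u]] \<phi>_counit[OF u] X.squares_hcomp_unit[OF sa] by simp
  finally show ?thesis by (simp add: a_def)
qed

text \<open>Here \<open>a\<close> is the usual transpose of \<open>g\<close> along the unit on
  objects. Since \<open>unit_vid\<close> is available, \<open>\<phi>_eq_unit_hcomp\<close> becomes a
  horizontal composite of two vertical identity squares.\<close>

lemma \<phi>_sq_vid:
  assumes g: "g \<in> Hor A" "hdom A g = on_obj F (on_obj G C)" "hcod A g = C"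
  defines "a \<equiv> unit_obj (on_obj G C) \<cdot>\<^bsub>X\<^esub> on_hor G g"
  shows "\<phi> (on_ver G (vid A C)) (vid A C) (sq_vid A g) = sq_vid X a"
    and "tside X (sq_vid X a) = a" "bside X (sq_vid X a) = a"
proof -
  have C: "C \<in> Obj A" using A.hor_closed g by auto
  note GC = G.on_obj[OF C]
  note o = unit_obj_hor[OF GC]
  have Gg: "on_hor G g \<in> Hor X" "hcod X (unit_obj (on_obj G C)) = hdom X (on_hor G g)"
    using G.on_hor g o by simp_all
  have Gu: "on_ver G (vid A C) \<in> Ver X" using G.on_ver A.vid_closed[OF C] by blast
  show "\<phi> (on_ver G (vid A C)) (vid A C) (sq_vid A g) = sq_vid X a"
    using \<phi>_eq_unit_hcomp[OF Gu sq_vid_in_squares[OF g]] G.pres_vid[OF C] unit_vid[OF GC]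
      G.pres_sq_vid[OF g(1)] X.sq_vid_hcomp[OF o(1) Gg] by (simp add: a_def)
  have "a \<in> Hor X" using X.hcomp_closed[OF o(1) Gg] by (simp add: a_def)
  then show "tside X (sq_vid X a) = a" "bside X (sq_vid X a) = a"
    using X.sq_vid_closed by blast+
qed

text \<open>Uniqueness in the universal property of the counit: \<open>g\<close> and
  \<open>counit_obj C\<close> have the same transpose, so injectivity of \<phi> identifies their
  vertical identity squares and therefore the tops of these.\<close>

lemma eq_counit_obj:
  assumes g: "g \<in> Hor A" "hdom A g = on_obj F (on_obj G C)" "hcod A g = C"
    and "unit_obj (on_obj G C) \<cdot>\<^bsub>X\<^esub> on_hor G g = hid X (on_obj G C)"
  shows "g = counit_obj C"
proof -
  have C: "C \<in> Obj A" using A.hor_closed g by auto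
  note e = counit_obj_hor[OF C]
  have Gu: "on_ver G (vid A C) \<in> Ver X" using G.on_ver A.vid_closed[OF C] by blast
  have "\<phi> (on_ver G (vid A C)) (vid A C) (sq_vid A g)
      = \<phi> (on_ver G (vid A C)) (vid A C) (sq_vid A (counit_obj C))"
    using \<phi>_sq_vid(1)[OF g] \<phi>_sq_vid(1)[OF e] counit_triangle_obj[OF C] assms(4) by simp
  then have "sq_vid A g = sq_vid A (counit_obj C)"
    using \<phi>_inject[OF Gu sq_vid_in_squares[OF g] sq_vid_in_squares[OF e]] by simp
  then show ?thesis using A.sq_vid_closed g(1) e(1) by metis
qed

text \<open>The top and the bottom of \<open>counit k\<close> each have a horizontal identity as
  transpose, which determines them by \<open>eq_counit_obj\<close>.\<close>

lemma counit_sides: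
  assumes k: "k \<in> Ver A"
  shows "tside A (counit k) = counit_obj (vdom A k)" "bside A (counit k) = counit_obj (vcod A k)"
proof -
  note t = counit_tside_hor[OF k] and b = counit_bside_hor[OF k]
  show "tside A (counit k) = counit_obj (vdom A k)"
    using eq_counit_obj[OF t] \<phi>_sq_vid[OF t] \<phi>_sq_vid_tside_counit[OF k] by simp
  show "bside A (counit k) = counit_obj (vcod A k)"
    using eq_counit_obj[OF b] \<phi>_sq_vid[OF b] \<phi>_sq_vid_bside_counit[OF k] by simp
qed

text \<open>By \<open>counit_sides\<close> the two counits can be stacked. Their composite and the
  counit of the composite both have the horizontal identity square as image under \<phi>.\<close>

lemma counit_vcomp:
  assumes k: "k\<^sub>1 \<in> Ver A" "k\<^sub>2 \<in> Ver A" "vcod A k\<^sub>1 = vdom A k\<^sub>2"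
  shows "counit (k\<^sub>1 \<bullet>\<^bsub>A\<^esub> k\<^sub>2) = counit k\<^sub>1 \<ominus>\<^bsub>A\<^esub> counit k\<^sub>2"
proof -
  have kk: "k\<^sub>1 \<bullet>\<^bsub>A\<^esub> k\<^sub>2 \<in> Ver A" using A.vcomp_closed k by blast
  have Gk: "on_ver G k\<^sub>1 \<in> Ver X" "on_ver G k\<^sub>2 \<in> Ver X"
    "vcod X (on_ver G k\<^sub>1) = vdom X (on_ver G k\<^sub>2)"
    using G.on_ver k by simp_all
  note Gkk = G.pres_vcomp[OF k] and FGkk = F.pres_vcomp[OF Gk]
  note c = counit_in_squares[OF k(1)] counit_in_squares[OF k(2)]
  have s: "bside A (counit k\<^sub>1) = tside A (counit k\<^sub>2)" using counit_sides k by simp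
  have "\<phi> (on_ver G (k\<^sub>1 \<bullet>\<^bsub>A\<^esub> k\<^sub>2)) (k\<^sub>1 \<bullet>\<^bsub>A\<^esub> k\<^sub>2) (counit k\<^sub>1 \<ominus>\<^bsub>A\<^esub> counit k\<^sub>2)
      = \<phi> (on_ver G (k\<^sub>1 \<bullet>\<^bsub>A\<^esub> k\<^sub>2)) (k\<^sub>1 \<bullet>\<^bsub>A\<^esub> k\<^sub>2) (counit (k\<^sub>1 \<bullet>\<^bsub>A\<^esub> k\<^sub>2))"
    using \<phi>_vcomp(2)[OF Gk c s] \<phi>_counit[OF k(1)] \<phi>_counit[OF k(2)] \<phi>_counit[OF kk] Gkk
      X.sq_hid_vcomp[OF Gk] by simp
  moreover have "counit k\<^sub>1 \<ominus>\<^bsub>A\<^esub> counit k\<^sub>2 \<in> squares A (on_ver F (on_ver G (k\<^sub>1 \<bullet>\<^bsub>A\<^esub> k\<^sub>2))) (k\<^sub>1 \<bullet>\<^bsub>A\<^esub> k\<^sub>2)"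
    using A.squares_vcomp(1)[OF c s] Gkk FGkk by simp
  moreover have "on_ver G (k\<^sub>1 \<bullet>\<^bsub>A\<^esub> k\<^sub>2) \<in> Ver X" using G.on_ver kk by blast
  ultimately show ?thesis using \<phi>_inject counit_in_squares[OF kk] by metis
qed

section \<open>Naturality of the unit and the counit\<close>

text \<open>Both sides compute \<phi> at \<open>on_sq F \<sigma>\<close>, one by naturality in
  \<open>j\<close>, the other by the Yoneda formula.\<close>

lemma unit_natural:
  assumes \<sigma>: "\<sigma> \<in> squares X j k"
  shows "\<sigma> \<parallel>\<^bsub>X\<^esub> unit k = unit j \<parallel>\<^bsub>X\<^esub> on_sq G (on_sq F \<sigma>)"
proof -
  note v = X.squares_Ver[OF \<sigma>] and F\<sigma> = F.squares_on_sq[OF \<sigma>]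
  show ?thesis
    using \<phi>_left[OF \<sigma> F_hid[OF v(2)]] \<phi>_eq_unit_hcomp[OF v(1) F\<sigma>] A.squares_hcomp_unit[OF F\<sigma>]
    by (simp add: unit_def)
qed

text \<open>Both sides have image \<open>on_sq G \<tau>\<close> under \<phi>, by naturality in
  \<open>j\<close> and in \<open>k\<close> respectively.\<close>

lemma counit_natural:
  assumes \<tau>: "\<tau> \<in> squares A j k"
  shows "on_sq F (on_sq G \<tau>) \<parallel>\<^bsub>A\<^esub> counit k = counit j \<parallel>\<^bsub>A\<^esub> \<tau>"
proof -
  note v = A.squares_Ver[OF \<tau>] and G\<tau> = G.squares_on_sq[OF \<tau>]
  note c = counit_in_squares[OF v(1)] counit_in_squares[OF v(2)]
  have Gj: "on_ver G j \<in> Ver X" using G.on_ver v by blast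
  show ?thesis
    by (rule \<phi>_inject[OF Gj A.squares_hcomp[OF F.squares_on_sq[OF G\<tau>] c(2)] A.squares_hcomp[OF c(1) \<tau>]])
      (use \<phi>_left[OF G\<tau> c(2)] \<phi>_right[OF Gj c(1) \<tau>] \<phi>_counit v X.squares_hcomp_unit[OF G\<tau>] in simp)
qed

lemma unit_transformation:
  "strict_horizontal_transformation X X id_map (G \<circ>\<^sub>d F) unit_obj unit"
  by unfold_locales
    (use unit_obj_hor unit_in_squares unit_sides unit_vid unit_composable(2) unit_natural
      in \<open>auto simp: id_map_def comp_map_def squares_iff\<close>)

lemma counit_transformation:
  "strict_horizontal_transformation A A (F \<circ>\<^sub>d G) id_map counit_obj counit"
  by unfold_locales
    (use counit_obj_hor counit_in_squares counit_sides counit_vid counit_vcomp counit_natural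
      in \<open>auto simp: id_map_def comp_map_def squares_iff\<close>)

lemma unit_counit_triangles: "triangle_identities X A F G unit_obj unit counit_obj counit"
  using unit_triangle counit_triangle unit_triangle_obj counit_triangle_obj
  by (simp add: triangle_identities_def)

end

theorem theorem5p4:
  fixes X :: "('o, 'h, 'v, 's) double_cat"
    and A :: "('p, 'i, 'w, 't) double_cat"
    and F :: "('o, 'h, 'v, 's, 'p, 'i, 'w, 't) double_map"
    and G :: "('p, 'i, 'w, 't, 'o, 'h, 'v, 's) double_map"
  assumes "normal_vertically_weak_double_category A"
    and "normal_vertically_weak_double_category X"
    and "strict_double_functor X A F"
    and "strict_double_functor A X G"
  shows
    "(\<exists>\<eta>o \<eta>v \<epsilon>o \<epsilon>v.
        strict_horizontal_transformation X X id_map (G \<circ>\<^sub>d F) \<eta>o \<eta>v \<and>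
        strict_horizontal_transformation A A (F \<circ>\<^sub>d G) id_map \<epsilon>o \<epsilon>v \<and>
        triangle_identities X A F G \<eta>o \<eta>v \<epsilon>o \<epsilon>v)
     \<longleftrightarrow>
     (\<exists>\<phi>.
        (\<forall>j \<in> Ver X. \<forall>k \<in> Ver A.
           bij_betw (\<phi> j k) (squares A (on_ver F j) k) (squares X j (on_ver G k))) \<and>
        natural_in_left X A F \<phi> \<and>
        natural_in_right X A F G \<phi> \<and>
        vertically_compatible X A F \<phi>)"
proof -
  interpret opposite_double_functors X A F G
    using assms by (simp add: opposite_double_functors_def)
  show ?thesis
  proof (rule iffI; elim exE conjE)
    fix \<eta>o \<eta>v \<epsilon>o \<epsilon>v
    assume "strict_horizontal_transformation X X id_map (G \<circ>\<^sub>d F) \<eta>o \<eta>v"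
      and "strict_horizontal_transformation A A (F \<circ>\<^sub>d G) id_map \<epsilon>o \<epsilon>v"
      and "triangle_identities X A F G \<eta>o \<eta>v \<epsilon>o \<epsilon>v"
    then interpret double_adjunction X A F G \<eta>o \<eta>v \<epsilon>o \<epsilon>v
      by (intro double_adjunction.intro double_adjunction_axioms.intro opposite_double_functors_axioms)
    show "\<exists>\<phi>.
        (\<forall>j \<in> Ver X. \<forall>k \<in> Ver A.
           bij_betw (\<phi> j k) (squares A (on_ver F j) k) (squares X j (on_ver G k))) \<and>
        natural_in_left X A F \<phi> \<and>
        natural_in_right X A F G \<phi> \<and>
        vertically_compatible X A F \<phi>"
      using bij_betw_transpose natural_in_left_transpose natural_in_right_transpose
        vertically_compatible_transpose by blast
  next
    fix \<phi>
    assume "\<forall>j \<in> Ver X. \<forall>k \<in> Ver A.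
        bij_betw (\<phi> j k) (squares A (on_ver F j) k) (squares X j (on_ver G k))"
      and "natural_in_left X A F \<phi>" "natural_in_right X A F G \<phi>" "vertically_compatible X A F \<phi>"
    then interpret compatible_transposition X A F G \<phi>
      by unfold_locales blast+
    show "\<exists>\<eta>o \<eta>v \<epsilon>o \<epsilon>v.
        strict_horizontal_transformation X X id_map (G \<circ>\<^sub>d F) \<eta>o \<eta>v \<and>
        strict_horizontal_transformation A A (F \<circ>\<^sub>d G) id_map \<epsilon>o \<epsilon>v \<and>
        triangle_identities X A F G \<eta>o \<eta>v \<epsilon>o \<epsilon>v"
      using unit_transformation counit_transformation unit_counit_triangles by blast
  qed
qed

end
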